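(* Let $F$ be a formally real Pythagorean field and let $Q=(t,t)$ be the quaternion central division algebra over $F((t))$. Let $\sigma=\mathrm{Int}(i)\circ\gamma$, an orthogonal involution on $Q$, where $\gamma$ is the canonical involution on $Q$. Then there exists a sum of hermitian squares in $(Q,\sigma)$ that is not itself a hermitian square in $(Q,\sigma)$.
   Context: A field is formally real if $-1$ is not a sum of squares in it, and Pythagorean if every sum of squares in it is a square. $F((t))$ is the field of formal Laurent series in $t$ over $F$. $(a,b)$ over a field $E$ denotes the quaternion algebra over $E$ generated by $i,j$ with $i^2=a$, $j^2=b$, $ij=-ji$; put $k=ij$. Its canonical involution is $\gamma(x_0+x_1i+x_2j+x_3k)=x_0-x_1i-x_2j-x_3k$. $\mathrm{Int}(i)$ is the inner automorphism $x\mapsto i x i^{-1}$. A hermitian square in $(Q,\sigma)$ is an element of the form $x\sigma(x)$ with $x\in Q$. *)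

theory Defs
  imports
    "HOL-Algebra.Ring"
    "HOL-Computational_Algebra.Formal_Laurent_Series"
begin

section \<open>Formally real and Pythagorean fields\<close>

definition sum_of_squares :: "'a::field \<Rightarrow> bool" where
  "sum_of_squares x \<longleftrightarrow> (\<exists>(n::nat) f. x = (\<Sum>l<n. (f l)\<^sup>2))"

definition formally_real :: "'a::field itself \<Rightarrow> bool" where
  "formally_real _ \<longleftrightarrow> \<not> sum_of_squares (- 1 :: 'a)"

definition pythagorean :: "'a::field itself \<Rightarrow> bool" where
  "pythagorean _ \<longleftrightarrow> (\<forall>x::'a. sum_of_squares x \<longrightarrow> (\<exists>y. x = y\<^sup>2))"


section \<open>Quaternion algebras\<close>

text \<open>\<open>Quat x0 x1 x2 x3\<close> stands for \<open>x0 + x1 i + x2 j + x3 k\<close>, where \<open>k = ij\<close>.\<close>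

datatype 'e quat = Quat 'e 'e 'e 'e

fun quat_add :: "'e::field quat \<Rightarrow> 'e quat \<Rightarrow> 'e quat" where
  "quat_add (Quat x0 x1 x2 x3) (Quat y0 y1 y2 y3) = Quat (x0 + y0) (x1 + y1) (x2 + y2) (x3 + y3)"

text \<open>The structure constants are forced by \<open>i\<^sup>2 = a\<close>, \<open>j\<^sup>2 = b\<close> and \<open>k = ij = -ji\<close>:
  they give \<open>k\<^sup>2 = -ab\<close>, \<open>ik = -ki = aj\<close> and \<open>kj = -jk = bi\<close>.\<close>

fun quat_mult :: "'e::field \<Rightarrow> 'e \<Rightarrow> 'e quat \<Rightarrow> 'e quat \<Rightarrow> 'e quat" where
  "quat_mult a b (Quat x0 x1 x2 x3) (Quat y0 y1 y2 y3) =
     Quat (x0 * y0 + a * x1 * y1 + b * x2 * y2 - a * b * x3 * y3)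
          (x0 * y1 + x1 * y0 - b * x2 * y3 + b * x3 * y2)
          (x0 * y2 + x2 * y0 + a * x1 * y3 - a * x3 * y1)
          (x0 * y3 + x3 * y0 + x1 * y2 - x2 * y1)"

definition quaternion_algebra :: "'e::field \<Rightarrow> 'e \<Rightarrow> 'e quat ring" where
  "quaternion_algebra a b =
     \<lparr>carrier = UNIV, monoid.mult = quat_mult a b, one = Quat 1 0 0 0,
      zero = Quat 0 0 0 0, add = quat_add\<rparr>"

definition quat_scalar :: "'e::field \<Rightarrow> 'e quat" where
  "quat_scalar c = Quat c 0 0 0"

definition quat_i :: "'e::field quat" where
  "quat_i = Quat 0 1 0 0"

definition quat_j :: "'e::field quat" where
  "quat_j = Quat 0 0 1 0"

definition quat_k :: "'e::field quat" where
  "quat_k = Quat 0 0 0 1"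

text \<open>The canonical involution \<open>\<gamma>\<close>.\<close>

fun quat_conj :: "'e::field quat \<Rightarrow> 'e quat" where
  "quat_conj (Quat x0 x1 x2 x3) = Quat x0 (- x1) (- x2) (- x3)"

definition inner_automorphism :: "('b, 'm) ring_scheme \<Rightarrow> 'b \<Rightarrow> 'b \<Rightarrow> 'b" where
  "inner_automorphism R u x = u \<otimes>\<^bsub>R\<^esub> x \<otimes>\<^bsub>R\<^esub> inv\<^bsub>R\<^esub> u"


section \<open>Hermitian squares\<close>

definition hermitian_square :: "('b, 'm) ring_scheme \<Rightarrow> ('b \<Rightarrow> 'b) \<Rightarrow> 'b \<Rightarrow> bool" where
  "hermitian_square R \<sigma> h \<longleftrightarrow> (\<exists>x \<in> carrier R. h = x \<otimes>\<^bsub>R\<^esub> \<sigma> x)"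

definition sum_of_hermitian_squares :: "('b, 'm) ring_scheme \<Rightarrow> ('b \<Rightarrow> 'b) \<Rightarrow> 'b \<Rightarrow> bool" where
  "sum_of_hermitian_squares R \<sigma> s \<longleftrightarrow>
     (\<exists>(n::nat) h. (\<forall>l<n. hermitian_square R \<sigma> (h l)) \<and> s = (\<Oplus>\<^bsub>R\<^esub>l\<in>{..<n}. h l))"


section \<open>Basic properties of quaternion algebras\<close>

lemma quaternion_algebra_simps [simp]:
  "carrier (quaternion_algebra a b) = UNIV"
  "monoid.mult (quaternion_algebra a b) = quat_mult a b"
  "one (quaternion_algebra a b) = Quat 1 0 0 0"
  "zero (quaternion_algebra a b) = Quat 0 0 0 0"
  "add (quaternion_algebra a b) = quat_add"
  by (simp_all add: quaternion_algebra_def)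

lemma quaternion_algebra_ring: "ring (quaternion_algebra a b)"
proof (rule ringI)
  show "abelian_group (quaternion_algebra a b)"
  proof (rule abelian_groupI, goal_cases)
    case (3 x y z)
    show ?case by (cases x; cases y; cases z) (simp add: algebra_simps)
  next
    case (4 x y)
    show ?case by (cases x; cases y) (simp add: algebra_simps)
  next
    case (5 x)
    show ?case by (cases x) simp
  next
    case (6 x)
    show ?case
      by (cases x) (auto intro!: exI[of _ "quat_mult a b (Quat (- 1) 0 0 0) x"])
  qed auto
  show "monoid (quaternion_algebra a b)"
  proof (rule monoidI, goal_cases)
    case (3 x y z)
    show ?case by (cases x; cases y; cases z) (simp add: algebra_simps)
  next
    case (4 x)
    show ?case by (cases x) simp
  next
    case (5 x)
    show ?case by (cases x) simp
  qed auto
  show "(x \<oplus>\<^bsub>quaternion_algebra a b\<^esub> y) \<otimes>\<^bsub>quaternion_algebra a b\<^esub> z =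
        x \<otimes>\<^bsub>quaternion_algebra a b\<^esub> z \<oplus>\<^bsub>quaternion_algebra a b\<^esub> y \<otimes>\<^bsub>quaternion_algebra a b\<^esub> z" for x y z
    by (cases x; cases y; cases z) (simp add: algebra_simps)
  show "z \<otimes>\<^bsub>quaternion_algebra a b\<^esub> (x \<oplus>\<^bsub>quaternion_algebra a b\<^esub> y) =
        z \<otimes>\<^bsub>quaternion_algebra a b\<^esub> x \<oplus>\<^bsub>quaternion_algebra a b\<^esub> z \<otimes>\<^bsub>quaternion_algebra a b\<^esub> y" for x y z
    by (cases x; cases y; cases z) (simp add: algebra_simps)
qed

lemma quaternion_algebra_relations:
  "quat_mult a b quat_i quat_i = quat_scalar a"
  "quat_mult a b quat_j quat_j = quat_scalar b"
  "quat_mult a b quat_i quat_j = quat_k"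
  "quat_mult a b quat_j quat_i = quat_mult a b (quat_scalar (- 1)) quat_k"
  by (simp_all add: quat_i_def quat_j_def quat_k_def quat_scalar_def)

lemma quaternion_algebra_center:
  assumes "(2::'e::field) \<noteq> 0" "a \<noteq> 0" "b \<noteq> 0"
  shows "(\<forall>y::'e quat. quat_mult a b x y = quat_mult a b y x) \<longleftrightarrow> x \<in> range quat_scalar"
proof
  obtain x0 x1 x2 x3 where x: "x = Quat x0 x1 x2 x3" by (cases x)
  have two: "c = 0" if "c = - c" for c :: 'e
  proof -
    have "2 * c = c + c" by simp
    also have "\<dots> = 0" using that by (simp add: eq_neg_iff_add_eq_0)
    finally show ?thesis using assms(1) by simp
  qed
  assume comm: "\<forall>y. quat_mult a b x y = quat_mult a b y x"
  have "x3 = - x3" "x2 = - x2"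
    using spec[OF comm, of quat_i] assms(2) x
    by (auto simp: quat_i_def neg_eq_iff_add_eq_0 eq_neg_iff_add_eq_0 simp flip: distrib_left)
  moreover have "x1 = - x1"
    using spec[OF comm, of quat_j] x by (auto simp: quat_j_def)
  ultimately have "x1 = 0" "x2 = 0" "x3 = 0" using two by blast+
  thus "x \<in> range quat_scalar" using x by (auto simp: quat_scalar_def)
next
  assume "x \<in> range quat_scalar"
  then obtain c where c: "x = Quat c 0 0 0" by (auto simp: quat_scalar_def)
  show "\<forall>y. quat_mult a b x y = quat_mult a b y x"
  proof
    fix y show "quat_mult a b x y = quat_mult a b y x"
      by (cases y) (simp add: c mult.commute)
  qed
qed

lemma quat_norm:
  "quat_mult a b (Quat x0 x1 x2 x3) (quat_conj (Quat x0 x1 x2 x3)) =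
     quat_scalar (x0\<^sup>2 - a * x1\<^sup>2 - b * x2\<^sup>2 + a * b * x3\<^sup>2)"
  "quat_mult a b (quat_conj (Quat x0 x1 x2 x3)) (Quat x0 x1 x2 x3) =
     quat_scalar (x0\<^sup>2 - a * x1\<^sup>2 - b * x2\<^sup>2 + a * b * x3\<^sup>2)"
  by (simp_all add: quat_scalar_def power2_eq_square algebra_simps)

lemma inv_quat_i:
  assumes "a \<noteq> 0"
  shows "inv\<^bsub>quaternion_algebra a b\<^esub> quat_i = Quat 0 (inverse a) 0 0"
proof -
  interpret ring "quaternion_algebra a b" by (rule quaternion_algebra_ring)
  show ?thesis
    using assms by (intro inv_char) (auto simp: quat_i_def)
qed

text \<open>The involution \<open>Int(i) \<circ> \<gamma>\<close> in coordinates.\<close>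

lemma inner_i_conj:
  assumes "a \<noteq> 0"
  shows "(inner_automorphism (quaternion_algebra a b) quat_i \<circ> quat_conj) (Quat x0 x1 x2 x3) =
           Quat x0 (- x1) x2 x3"
  using assms by (simp add: inner_automorphism_def inv_quat_i) (simp add: quat_i_def)

lemma inner_i_conj_involution:
  fixes a b :: "'e::field"
  assumes "a \<noteq> 0"
  defines "\<sigma> \<equiv> inner_automorphism (quaternion_algebra a b) quat_i \<circ> quat_conj"
  shows "\<sigma> (quat_add x y) = quat_add (\<sigma> x) (\<sigma> y)"
    and "\<sigma> (quat_mult a b x y) = quat_mult a b (\<sigma> y) (\<sigma> x)"
    and "\<sigma> (\<sigma> x) = x"
    and "\<sigma> (quat_scalar c) = quat_scalar c"
  unfolding \<sigma>_def quat_scalar_def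
  by (cases x; cases y; simp add: inner_i_conj[OF assms(1)] algebra_simps del: o_apply)+

text \<open>The symmetric elements form the three-dimensional space spanned by \<open>1, j, k\<close>, so this
  involution is orthogonal.\<close>

lemma inner_i_conj_symmetric:
  assumes "(2::'e::field) \<noteq> 0" "a \<noteq> (0::'e)"
  shows "(inner_automorphism (quaternion_algebra a b) quat_i \<circ> quat_conj) (Quat x0 x1 x2 x3) =
           Quat x0 x1 x2 x3 \<longleftrightarrow> x1 = 0"
proof -
  have "2 * x1 = 0" if "- x1 = x1"
    using that by (metis add.right_inverse mult_2)
  thus ?thesis using assms by (auto simp: inner_i_conj simp del: o_apply)
qed


section \<open>The algebra \<open>(t, t)\<close> over Laurent series is a division algebra\<close>

lemma sum_of_squares_add:
  assumes "sum_of_squares x" "sum_of_squares y"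
  shows "sum_of_squares (x + y)"
proof -
  obtain m f n g where f: "x = (\<Sum>l<(m::nat). (f l)\<^sup>2)" and g: "y = (\<Sum>l<(n::nat). (g l)\<^sup>2)"
    using assms by (auto simp: sum_of_squares_def)
  have "(\<Sum>l<m+n. (if l < m then f l else g (l - m))\<^sup>2) = x + y"
    unfolding f g by (induction n) simp_all
  thus ?thesis unfolding sum_of_squares_def by metis
qed

lemma sum_of_squares_square: "sum_of_squares (x\<^sup>2)"
  unfolding sum_of_squares_def by (rule exI[of _ 1], rule exI[of _ "\<lambda>_. x"]) simp

lemma formally_real_two_squares:
  fixes x y :: "'a::field"
  assumes "formally_real TYPE('a)" "x\<^sup>2 + y\<^sup>2 = 0"
  shows "x = 0 \<and> y = 0"
proof -
  have *: "v = 0" if "u\<^sup>2 + v\<^sup>2 = 0" for u v :: 'a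
  proof (rule ccontr)
    assume "v \<noteq> 0"
    moreover have "u\<^sup>2 = - v\<^sup>2" using that by (simp add: add_eq_0_iff2)
    ultimately have "(u / v)\<^sup>2 = - 1" by (simp add: power_divide)
    thus False using assms(1) sum_of_squares_square[of "u / v"] by (simp add: formally_real_def)
  qed
  show ?thesis using *[of x y] *[of y x] assms(2) by (simp add: add.commute)
qed

lemma formally_real_two_neq_0:
  assumes "formally_real TYPE('a::field)"
  shows "(2::'a) \<noteq> 0"
  using formally_real_two_squares[OF assms, of 1 1] by auto

text \<open>A nonzero sum of two squares of Laurent series has even order.\<close>

lemma fls_two_squares:
  fixes f g :: "'a::field fls"
  assumes "formally_real TYPE('a)" "f \<noteq> 0 \<or> g \<noteq> 0"
  shows "f\<^sup>2 + g\<^sup>2 \<noteq> 0" "even (fls_subdegree (f\<^sup>2 + g\<^sup>2))"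
proof -
  have sub: "fls_subdegree (h\<^sup>2) = 2 * fls_subdegree h" for h :: "'a fls"
    by (simp add: fls_subdegree_pow)
  have main: "u\<^sup>2 + v\<^sup>2 \<noteq> 0 \<and> fls_subdegree (u\<^sup>2 + v\<^sup>2) = 2 * fls_subdegree u"
    if u: "u \<noteq> 0" and uv: "v = 0 \<or> fls_subdegree u \<le> fls_subdegree v" for u v :: "'a fls"
  proof (cases "v = 0")
    case True
    thus ?thesis using u by (simp add: sub)
  next
    case v: False
    define d where "d = fls_subdegree u"
    have base: "fls_nth (h\<^sup>2) (2 * fls_subdegree h) = (fls_nth h (fls_subdegree h))\<^sup>2" for h :: "'a fls"
      using fls_times_base[of h h] by (simp add: power2_eq_square)
    have "fls_nth (v\<^sup>2) (2 * d) = (fls_nth v d)\<^sup>2"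
    proof (cases "fls_subdegree v = d")
      case True
      thus ?thesis using base[of v] by simp
    next
      case False
      hence "d < fls_subdegree v" using uv v by (simp add: d_def)
      thus ?thesis by (simp add: sub)
    qed
    hence "fls_nth (u\<^sup>2 + v\<^sup>2) (2 * d) = (fls_nth u d)\<^sup>2 + (fls_nth v d)\<^sup>2"
      using base[of u] by (simp add: d_def)
    moreover have "fls_nth u d \<noteq> 0" using u by (simp add: d_def)
    ultimately have nz: "fls_nth (u\<^sup>2 + v\<^sup>2) (2 * d) \<noteq> 0"
      using formally_real_two_squares[OF assms(1), of "fls_nth u d" "fls_nth v d"] by auto
    have low: "fls_nth (u\<^sup>2 + v\<^sup>2) k = 0" if "k < 2 * d" for k
      using that uv v by (simp add: d_def sub)
    from nz low have "fls_subdegree (u\<^sup>2 + v\<^sup>2) = 2 * d" by (intro fls_subdegree_eqI) auto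
    moreover have "u\<^sup>2 + v\<^sup>2 \<noteq> 0"
    proof
      assume "u\<^sup>2 + v\<^sup>2 = 0"
      thus False using nz by (simp only: fls_zero_nth) simp
    qed
    ultimately show ?thesis by (simp add: d_def)
  qed
  have "f\<^sup>2 + g\<^sup>2 \<noteq> 0 \<and> even (fls_subdegree (f\<^sup>2 + g\<^sup>2))"
  proof (cases "f \<noteq> 0 \<and> (g = 0 \<or> fls_subdegree f \<le> fls_subdegree g)")
    case True
    thus ?thesis using main[of f g] by simp
  next
    case False
    thus ?thesis using main[of g f] assms(2) by (auto simp: add.commute)
  qed
  thus "f\<^sup>2 + g\<^sup>2 \<noteq> 0" "even (fls_subdegree (f\<^sup>2 + g\<^sup>2))" by auto
qed

lemma quaternion_algebra_X_X_division:
  assumes "formally_real TYPE('a::field)"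
  shows "Units (quaternion_algebra (fls_X :: 'a fls) fls_X) = UNIV - {Quat 0 0 0 0}"
proof -
  let ?t = "fls_X :: 'a fls"
  let ?Q = "quaternion_algebra ?t ?t"
  have "x \<in> Units ?Q" if "x \<noteq> Quat 0 0 0 0" for x
  proof -
    obtain x0 x1 x2 x3 where x: "x = Quat x0 x1 x2 x3" by (cases x)
    define N where "N = x0\<^sup>2 - ?t * x1\<^sup>2 - ?t * x2\<^sup>2 + ?t * ?t * x3\<^sup>2"
    define A where "A = x0\<^sup>2 + (?t * x3)\<^sup>2"
    define B where "B = x1\<^sup>2 + x2\<^sup>2"
    have NAB: "N = A - ?t * B"
      by (simp add: N_def A_def B_def power2_eq_square algebra_simps)
    have "N \<noteq> 0"
    proof
      assume "N = 0"
      hence eq: "A = ?t * B" by (simp add: NAB)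
      show False
      proof (cases "x1 \<noteq> 0 \<or> x2 \<noteq> 0")
        case True
        hence B: "B \<noteq> 0" "even (fls_subdegree B)"
          using fls_two_squares[OF assms] by (auto simp: B_def)
        hence "A \<noteq> 0" using eq by simp
        hence "x0 \<noteq> 0 \<or> ?t * x3 \<noteq> 0" unfolding A_def by (metis add_0 power_zero_numeral)
        hence "even (fls_subdegree A)"
          unfolding A_def by (rule fls_two_squares(2)[OF assms])
        moreover have "fls_subdegree A = fls_subdegree B + 1"
          unfolding eq by (rule fls_subdegree_mult_fls_X(1)[OF B(1)])
        ultimately show False using B(2) by simp
      next
        case False
        hence "A = 0" using eq by (simp add: B_def)
        hence "x0 = 0" "x3 = 0"
          using fls_two_squares(1)[OF assms, of x0 "?t * x3"] by (auto simp: A_def)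
        thus False using that False x by simp
      qed
    qed
    moreover have scal: "quat_mult ?t ?t x (quat_mult ?t ?t (quat_scalar c) (quat_conj x)) =
          quat_scalar (c * N)"
        "quat_mult ?t ?t (quat_mult ?t ?t (quat_scalar c) (quat_conj x)) x = quat_scalar (c * N)" for c
      by (simp_all add: x N_def quat_scalar_def power2_eq_square algebra_simps)
    ultimately show ?thesis
      using scal[of "inverse N"]
      by (auto simp: Units_def quat_scalar_def
          intro!: exI[of _ "quat_mult ?t ?t (Quat (inverse N) 0 0 0) (quat_conj x)"])
  qed
  moreover have "Quat 0 0 0 0 \<notin> Units ?Q"
  proof
    assume "Quat 0 0 0 0 \<in> Units ?Q"
    then obtain y where "quat_mult ?t ?t y (Quat 0 0 0 0) = Quat 1 0 0 0"
      by (auto simp: Units_def)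
    thus False by (cases y) simp
  qed
  ultimately show ?thesis by auto
qed

end

theory Submission
  imports Defs
begin

text \<open>The reduced norm of \<open>x \<sigma>(x)\<close> is the square of the reduced norm of \<open>x\<close>, so it has even order
  in \<open>t\<close>. The scalar part of a sum of hermitian squares can cancel, since
  \<open>i \<sigma>(i) + j \<sigma>(j) = - t + t\<close>. Perturbing \<open>i\<close> to \<open>i + k\<close> gives
  \<open>(i + k) \<sigma>(i + k) + j \<sigma>(j) = - t\<^sup>2 + 2 t j\<close>, whose reduced norm \<open>t\<^sup>3 (t - 4)\<close> has order 3.\<close>

lemma hermitian_square_reduced_norm:
  fixes a b :: "'e::field"
  assumes "a \<noteq> 0"
    and "hermitian_square (quaternion_algebra a b)
           (inner_automorphism (quaternion_algebra a b) quat_i \<circ> quat_conj) (Quat s0 s1 s2 s3)"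
  shows "\<exists>n. s0\<^sup>2 - a * s1\<^sup>2 - b * s2\<^sup>2 + a * b * s3\<^sup>2 = n\<^sup>2"
proof -
  obtain x where x: "Quat s0 s1 s2 s3 =
      quat_mult a b x ((inner_automorphism (quaternion_algebra a b) quat_i \<circ> quat_conj) x)"
    using assms(2) by (auto simp: hermitian_square_def simp del: o_apply)
  obtain x0 x1 x2 x3 where "x = Quat x0 x1 x2 x3" by (cases x)
  with x have "Quat s0 s1 s2 s3 = quat_mult a b (Quat x0 x1 x2 x3) (Quat x0 (- x1) x2 x3)"
    by (simp only: inner_i_conj[OF assms(1)])
  \<comment> \<open>The reduced norm is multiplicative, and \<open>\<sigma>\<close> preserves it
    because it only changes the sign of \<open>x1\<close>. In coordinates this is a polynomial
    identity.\<close>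
  hence "s0\<^sup>2 - a * s1\<^sup>2 - b * s2\<^sup>2 + a * b * s3\<^sup>2 =
      (x0\<^sup>2 - a * x1\<^sup>2 - b * x2\<^sup>2 + a * b * x3\<^sup>2)\<^sup>2"
    by clarsimp (simp add: power2_eq_square algebra_simps)
  thus ?thesis by blast
qed

lemma sum_of_hermitian_squares_add:
  fixes R (structure)
  assumes "ring R" "hermitian_square R \<sigma> g" "hermitian_square R \<sigma> h"
    and "g \<in> carrier R" "h \<in> carrier R"
  shows "sum_of_hermitian_squares R \<sigma> (g \<oplus> h)"
proof -
  interpret ring R by fact
  let ?f = "\<lambda>l::nat. if l = 0 then g else h"
  have "{..<2::nat} = {0, 1}" by auto
  hence "(\<Oplus>l\<in>{..<2}. ?f l) = g \<oplus> h"
    using assms(4,5) by (simp add: finsum_insert)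
  moreover have "\<forall>l<2. hermitian_square R \<sigma> (?f l)" using assms(2,3) by simp
  ultimately show ?thesis unfolding sum_of_hermitian_squares_def by metis
qed

theorem proposition3p12:
  assumes "formally_real TYPE('a::field)"
    and "pythagorean TYPE('a)"
  shows "let Q = quaternion_algebra (fls_X :: 'a fls) fls_X;
             \<sigma> = inner_automorphism Q quat_i \<circ> quat_conj
         in \<exists>s \<in> carrier Q. sum_of_hermitian_squares Q \<sigma> s \<and> \<not> hermitian_square Q \<sigma> s"
proof -
  let ?t = "fls_X :: 'a fls"
  define Q where "Q = quaternion_algebra ?t ?t"
  define \<sigma> where "\<sigma> = inner_automorphism Q quat_i \<circ> quat_conj"
  let ?s = "Quat (- (?t\<^sup>2)) 0 (2 * ?t) 0"
  have \<sigma>: "\<sigma> (Quat x0 x1 x2 x3) = Quat x0 (- x1) x2 x3" for x0 x1 x2 x3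
    unfolding \<sigma>_def Q_def by (rule inner_i_conj) simp
  have square: "hermitian_square Q \<sigma> (x \<otimes>\<^bsub>Q\<^esub> \<sigma> x)" for x
    by (auto simp: hermitian_square_def Q_def)
  have "?s = (Quat 0 1 0 1 \<otimes>\<^bsub>Q\<^esub> \<sigma> (Quat 0 1 0 1)) \<oplus>\<^bsub>Q\<^esub> (Quat 0 0 1 0 \<otimes>\<^bsub>Q\<^esub> \<sigma> (Quat 0 0 1 0))"
    unfolding \<sigma> by (simp add: Q_def power2_eq_square)
  also have "sum_of_hermitian_squares Q \<sigma> \<dots>"
    by (intro sum_of_hermitian_squares_add square) (simp_all add: Q_def quaternion_algebra_ring)
  finally have sum: "sum_of_hermitian_squares Q \<sigma> ?s" .
  have "\<not> hermitian_square Q \<sigma> ?s"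
  proof
    assume "hermitian_square Q \<sigma> ?s"
    then obtain n where n: "(- (?t\<^sup>2))\<^sup>2 - ?t * 0\<^sup>2 - ?t * (2 * ?t)\<^sup>2 + ?t * ?t * 0\<^sup>2 = n\<^sup>2"
      using hermitian_square_reduced_norm[OF fls_X_nonzero] unfolding \<sigma>_def Q_def by blast
    \<comment> \<open>The reduced norm of \<open>?s\<close> is \<open>?t ^ 4 - 4 * ?t ^ 3\<close>,
      and \<open>c\<close> is its cofactor after \<open>?t ^ 3\<close>. Writing the constant with
      \<open>fls_const\<close> makes its coefficients explicit.\<close>
    define c where "c = ?t - fls_const 4"
    \<comment> \<open>Formal reality enters here: in characteristic 2 the norm would collapse to the
      square \<open>?t ^ 4\<close>.\<close>
    have "(4 :: 'a) = 2 * 2" by simp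
    hence four: "(4 :: 'a) \<noteq> 0"
      using formally_real_two_neq_0[OF assms(1)] by (metis mult_eq_0_iff)
    \<comment> \<open>The constant coefficient of \<open>c\<close> is \<open>- 4\<close>, which is
      nonzero, and no lower coefficient occurs.\<close>
    hence c: "fls_subdegree c = 0" "c \<noteq> 0"
      by (auto simp: c_def intro!: fls_subdegree_eqI dest: arg_cong[where f = "\<lambda>f. fls_nth f 0"])
    have c_eq: "c = ?t - 4" by (simp add: c_def)
    have "n\<^sup>2 = ?t ^ 3 * c"
      unfolding n[symmetric] c_eq
      by (simp add: power2_eq_square power3_eq_cube algebra_simps)
    moreover have "fls_subdegree (?t ^ 3 * c) = 3"
      using c by (simp add: fls_subdegree_pow)
    \<comment> \<open>This covers \<open>n = 0\<close> as well, since the zero series has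
      \<open>fls_subdegree\<close> 0 by convention.\<close>
    moreover have "fls_subdegree (n\<^sup>2) = 2 * fls_subdegree n"
      by (simp add: fls_subdegree_pow)
    ultimately have "2 * fls_subdegree n = 3" by simp
    thus False by presburger
  qed
  moreover have "?s \<in> carrier Q" by (simp add: Q_def)
  ultimately show ?thesis
    using sum unfolding \<sigma>_def Q_def Let_def by blast
qed

end
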